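(* Let $D$ be a digraph and let $\mathfrak{B}$ be a non-empty set of infinite dibonds of $D$. Then the size (cardinality) of a smallest dibond in $\mathfrak{B}$ is equal to the size (cardinality) of a largest set of pairwise disjoint $\mathfrak{B}$-dijoins of $D$.
   Context: Digraphs may be infinite and may have parallel edges, but no loops. For disjoint sets $X,Y$ with $X\cup Y=V(D)$, $E_D(X,Y)$ is the set of edges with one endvertex in $X$ and the other in $Y$. A cut of $D$ is a set $B=E_D(X,Y)$ where $X,Y$ are non-empty, disjoint and have union $V(D)$. A bond is an inclusion-minimal non-empty cut. A dicut is a cut $B=E_D(X,Y)$ such that all edges of $B$ have their heads in the same one of the two sides $X,Y$. A dibond is a bond that is also a dicut. A $\mathfrak{B}$-dijoin is a set of edges of $D$ meeting every element of $\mathfrak{B}$. *)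

theory Defs
  imports "Graph_Theory.Digraph" "HOL-Library.Equipollence"
begin

definition cut_edges :: "('a,'b) pre_digraph \<Rightarrow> 'a set \<Rightarrow> 'a set \<Rightarrow> 'b set" where
  "cut_edges D X Y =
     {e \<in> arcs D. (tail D e \<in> X \<and> head D e \<in> Y) \<or> (tail D e \<in> Y \<and> head D e \<in> X)}"

definition bipartition :: "('a,'b) pre_digraph \<Rightarrow> 'a set \<Rightarrow> 'a set \<Rightarrow> bool" where
  "bipartition D X Y \<longleftrightarrow> X \<noteq> {} \<and> Y \<noteq> {} \<and> X \<inter> Y = {} \<and> X \<union> Y = verts D"

definition is_cut :: "('a,'b) pre_digraph \<Rightarrow> 'b set \<Rightarrow> bool" where
  "is_cut D B \<longleftrightarrow> (\<exists>X Y. bipartition D X Y \<and> B = cut_edges D X Y)"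

definition is_bond :: "('a,'b) pre_digraph \<Rightarrow> 'b set \<Rightarrow> bool" where
  "is_bond D B \<longleftrightarrow> is_cut D B \<and> B \<noteq> {} \<and>
     (\<forall>B'. is_cut D B' \<and> B' \<noteq> {} \<and> B' \<subseteq> B \<longrightarrow> B' = B)"

definition is_dicut :: "('a,'b) pre_digraph \<Rightarrow> 'b set \<Rightarrow> bool" where
  "is_dicut D B \<longleftrightarrow> (\<exists>X Y. bipartition D X Y \<and> B = cut_edges D X Y \<and>
     ((\<forall>e\<in>B. head D e \<in> X) \<or> (\<forall>e\<in>B. head D e \<in> Y)))"

definition is_dibond :: "('a,'b) pre_digraph \<Rightarrow> 'b set \<Rightarrow> bool" where
  "is_dibond D B \<longleftrightarrow> is_bond D B \<and> is_dicut D B"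

definition is_dijoin :: "('a,'b) pre_digraph \<Rightarrow> 'b set set \<Rightarrow> 'b set \<Rightarrow> bool" where
  "is_dijoin D \<BB> F \<longleftrightarrow> F \<subseteq> arcs D \<and> (\<forall>B\<in>\<BB>. F \<inter> B \<noteq> {})"

definition disjoint_dijoins :: "('a,'b) pre_digraph \<Rightarrow> 'b set set \<Rightarrow> 'b set set \<Rightarrow> bool" where
  "disjoint_dijoins D \<BB> \<JJ> \<longleftrightarrow> (\<forall>F\<in>\<JJ>. is_dijoin D \<BB> F) \<and> pairwise disjnt \<JJ>"

text \<open>
  Sizes are compared as (possibly infinite) cardinalities, by means of
  \<^const>\<open>lepoll\<close> and \<^const>\<open>eqpoll\<close>. The existence of a largest set of pairwise
  disjoint dijoins is not automatic: the supremum of the sizes might not be attained.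
\<close>

definition smallest_in :: "'b set set \<Rightarrow> 'b set \<Rightarrow> bool" where
  "smallest_in \<BB> B \<longleftrightarrow> B \<in> \<BB> \<and> (\<forall>B'\<in>\<BB>. B \<lesssim> B')"

definition largest_disjoint_dijoins ::
    "('a,'b) pre_digraph \<Rightarrow> 'b set set \<Rightarrow> 'b set set \<Rightarrow> bool" where
  "largest_disjoint_dijoins D \<BB> \<JJ> \<longleftrightarrow>
     disjoint_dijoins D \<BB> \<JJ> \<and> (\<forall>\<JJ>'. disjoint_dijoins D \<BB> \<JJ>' \<longrightarrow> \<JJ>' \<lesssim> \<JJ>)"

end

theory Submission
  imports Defs
begin

text \<open>
  Let \<open>C\<close> be a member of \<open>\<BB>\<close> of least cardinality. Pairwise disjoint dijoins
  meet \<open>C\<close> in disjoint non-empty sets, so there are at most \<open>|C|\<close> of them. To find \<open>|C|\<close>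
  many, colour the edges with the elements of \<open>C\<close> so that every member of \<open>\<BB>\<close> has all
  colours; the colour classes are then disjoint dijoins. The colouring is provided by
  \<open>bond_colouring\<close>, which colours the edges of any digraph with any infinite set \<open>C\<close> of
  colours so that every bond of size at least \<open>|C|\<close> has all colours.

  The heart of the proof is \<open>bond_meets_links\<close>. Given a set \<open>S\<close> of edges, link any two
  ends of edges of \<open>S\<close> that are connected in the graph without \<open>S\<close> by a finite connection
  there. A bond that meets \<open>S\<close> without being contained in \<open>S\<close> contains an edge
  of these links. The links are not much larger than \<open>S\<close>. Starting with a single edge, one
  can therefore add links again and again, in as many steps as \<open>C\<close> has elements, so that all
  stages remain smaller than \<open>C\<close>. Give each step one colour, and each colour to
  cofinally many steps. A bond of size at least \<open>|C|\<close> is contained in no stage. If it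
  meets some stage, it meets all later ones, hence also all later links, and so it has every colour.

  This produces a set of at most \<open>|C|\<close> coloured edges, which settles all large bonds that
  meet it. The construction also works relative to a set \<open>M\<close> of edges that are already
  coloured, for the bonds that avoid \<open>M\<close>: the links may use edges of \<open>M\<close>, but
  such bonds meet them elsewhere. Zorn's lemma therefore completes the colouring.
\<close>

unbundle cardinal_syntax

section \<open>Bonds and connections outside a set of edges\<close>

definition linked :: "('a,'b) pre_digraph \<Rightarrow> 'b set \<Rightarrow> 'a \<Rightarrow> 'a \<Rightarrow> bool" where
  "linked D F = (\<lambda>u v. \<exists>e\<in>F. {u, v} = {tail D e, head D e})\<^sup>*\<^sup>*"

definition ends :: "('a,'b) pre_digraph \<Rightarrow> 'b set \<Rightarrow> 'a set" where
  "ends D S = tail D ` S \<union> head D ` S"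

definition connector :: "('a,'b) pre_digraph \<Rightarrow> 'b set \<Rightarrow> 'a \<Rightarrow> 'a \<Rightarrow> 'b set" where
  "connector D F u v = (SOME P. finite P \<and> P \<subseteq> F \<and> linked D P u v)"

text \<open>
  A single finite connection is chosen for each pair of ends, which keeps the links finite if \<open>S\<close>
  is finite, and otherwise no larger than \<open>S\<close>.
\<close>
definition links :: "('a,'b) pre_digraph \<Rightarrow> 'b set \<Rightarrow> 'b set" where
  "links D S = (\<Union>(u, v) \<in> {(u, v) \<in> ends D S \<times> ends D S. linked D (arcs D - S) u v}.
     connector D (arcs D - S) u v)"

lemma linked_mono: "linked D F u v \<Longrightarrow> F \<subseteq> G \<Longrightarrow> linked D G u v"
  unfolding linked_def by (erule rtranclp_mono[THEN predicate2D, rotated]) blast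

lemma linked_trans: "linked D F u v \<Longrightarrow> linked D F v w \<Longrightarrow> linked D F u w"
  unfolding linked_def by (rule rtranclp_trans)

lemma linked_sym: "linked D F u v \<Longrightarrow> linked D F v u"
  unfolding linked_def
  by (rule sympD[OF symp_rtranclp]) (auto simp: symp_def insert_commute)

lemma linked_edge: "e \<in> F \<Longrightarrow> linked D F (tail D e) (head D e)"
  unfolding linked_def by blast

lemma linked_finite:
  assumes "linked D F u v"
  shows "\<exists>P. finite P \<and> P \<subseteq> F \<and> linked D P u v"
  using assms unfolding linked_def[of D F]
proof (induction rule: rtranclp_induct)
  case base
  have "linked D {} u u" unfolding linked_def by simp
  then show ?case by blast
next
  case (step v w)
  then obtain P e where P: "finite P" "P \<subseteq> F" "linked D P u v"
    and e: "e \<in> F" "{v, w} = {tail D e, head D e}"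
    by blast
  have "linked D (insert e P) u v"
    using P(3) by (rule linked_mono) blast
  moreover have "linked D (insert e P) v w"
    unfolding linked_def by (rule r_into_rtranclp) (use e(2) in blast)
  ultimately have "linked D (insert e P) u w"
    by (rule linked_trans)
  moreover have "finite (insert e P)" "insert e P \<subseteq> F" using P e by auto
  ultimately show ?case by blast
qed

lemma connector:
  assumes "linked D F u v"
  shows "finite (connector D F u v)" "connector D F u v \<subseteq> F"
    "linked D (connector D F u v) u v"
  using someI_ex[OF linked_finite[OF assms]] unfolding connector_def by blast+

lemma links_disjoint: "links D S \<inter> S = {}"
  using connector(2) unfolding links_def by fastforce

lemma linked_crosses_cut:
  assumes "wf_digraph D" "bipartition D X Y" "P \<subseteq> arcs D"
    and "linked D P u v" "u \<in> X" "v \<in> Y"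
  shows "P \<inter> cut_edges D X Y \<noteq> {}"
proof
  interpret wf_digraph D by fact
  assume none: "P \<inter> cut_edges D X Y = {}"
  have XY: "X \<inter> Y = {}" "X \<union> Y = verts D"
    using assms(2) unfolding bipartition_def by auto
  from assms(4) have "v \<in> X" unfolding linked_def
  proof (induction rule: rtranclp_induct)
    case base
    show ?case by fact
  next
    case (step v w)
    then obtain e where e: "e \<in> P" "{v, w} = {tail D e, head D e}" by blast
    then have "tail D e \<in> X \<union> Y" "head D e \<in> X \<union> Y"
      using assms(3) XY(2) by auto
    moreover have "e \<notin> cut_edges D X Y" "e \<in> arcs D" using none e(1) assms(3) by auto
    ultimately show ?case
      using e(2) step(3) unfolding cut_edges_def by (auto simp: doubleton_eq_iff)
  qed
  with assms(6) XY show False by blast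
qed

lemma is_bondE:
  assumes "is_bond D B"
  obtains X Y where "bipartition D X Y" "B = cut_edges D X Y"
  using assms unfolding is_bond_def is_cut_def by blast

text \<open>
  A bond that misses the links cannot separate two linked ends of \<open>S\<close>, so every component of the graph
  without \<open>S\<close> has all its ends of \<open>S\<close> on one side of the bond. An edge of the bond
  outside \<open>S\<close> lies inside such a component \<open>K\<close>, and the vertices of \<open>K\<close> on the other side
  are then separated from the rest of the graph by edges of the bond that avoid \<open>S\<close>.
  By minimality these are all edges of the bond, so the bond cannot meet \<open>S\<close>.
\<close>
lemma bond_meets_links:
  assumes wf: "wf_digraph D" and bond: "is_bond D B"
    and meets: "B \<inter> S \<noteq> {}" and notin: "\<not> B \<subseteq> S"
  shows "B \<inter> links D S \<noteq> {}"
proof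
  interpret wf_digraph D by fact
  assume none: "B \<inter> links D S = {}"
  obtain X Y where XY: "bipartition D X Y" and B: "B = cut_edges D X Y"
    using bond by (rule is_bondE)
  from notin obtain e where e: "e \<in> B" "e \<notin> S" by blast
  then have earc: "e \<in> arcs D - S" unfolding B cut_edges_def by simp
  define K where "K = {w. linked D (arcs D - S) (tail D e) w}"
  have eK: "tail D e \<in> K" "head D e \<in> K"
    unfolding K_def using linked_edge[OF earc] by (auto simp: linked_def)
  have K_closed: "tail D x \<in> K \<longleftrightarrow> head D x \<in> K" if "x \<in> arcs D - S" for x
    using linked_edge[OF that] linked_sym linked_trans unfolding K_def by (metis mem_Collect_eq)
  \<comment> \<open>A linked pair of ends on different sides would put an edge of \<open>B\<close> into the links.\<close>
  have one_side: "ends D S \<inter> K \<inter> X = {} \<or> ends D S \<inter> K \<inter> Y = {}"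
  proof (rule ccontr)
    assume "\<not> ?thesis"
    then obtain x y where x: "x \<in> ends D S" "x \<in> K" "x \<in> X" and y: "y \<in> ends D S" "y \<in> K" "y \<in> Y"
      by blast
    then have l: "linked D (arcs D - S) x y"
      unfolding K_def using linked_sym linked_trans by (metis mem_Collect_eq)
    have "connector D (arcs D - S) x y \<inter> B \<noteq> {}"
      unfolding B using connector[OF l] by (intro linked_crosses_cut[OF wf XY _ _ x(3) y(3)]) auto
    moreover have "connector D (arcs D - S) x y \<subseteq> links D S"
      unfolding links_def using l x y by blast
    ultimately show False using none by blast
  qed
  \<comment> \<open>Stated for an arbitrary choice of names for the two sides, since either side may contain the ends.\<close>
  have absurd: False if XY: "bipartition D X Y" and B: "B = cut_edges D X Y"
    and side: "ends D S \<inter> K \<inter> Y = {}" for X Y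
  proof -
    let ?W = "K \<inter> Y"
    define B' where "B' = cut_edges D ?W (verts D - ?W)"
    have disj: "X \<inter> Y = {}" and un: "X \<union> Y = verts D" and "X \<noteq> {}"
      using XY unfolding bipartition_def by auto
    \<comment> \<open>An edge of \<open>B'\<close> in \<open>S\<close> would have an end in \<open>K \<inter> Y\<close>; an edge of \<open>B'\<close> outside \<open>S\<close> cannot
        leave \<open>K\<close>, so it runs between the two sides.\<close>
    have inner: "x \<in> B - S" if "x \<in> B'" for x
    proof -
      have xarc: "x \<in> arcs D" and x: "tail D x \<in> ?W \<and> head D x \<notin> ?W \<or> head D x \<in> ?W \<and> tail D x \<notin> ?W"
        using that unfolding B'_def cut_edges_def by auto
      have "x \<notin> S" using x side unfolding ends_def by blast
      moreover have "tail D x \<in> X \<union> Y" "head D x \<in> X \<union> Y" using xarc un by auto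
      ultimately show ?thesis
        using K_closed[of x] x xarc unfolding B cut_edges_def by blast
    qed
    have "e \<in> B'"
      using e(1) eK earc disj un unfolding B B'_def cut_edges_def by auto
    moreover have "bipartition D ?W (verts D - ?W)"
    proof -
      have "?W \<noteq> {}" using e(1) eK unfolding B cut_edges_def by blast
      moreover have "verts D - ?W \<noteq> {}" using \<open>X \<noteq> {}\<close> disj un by blast
      ultimately show ?thesis using un unfolding bipartition_def by blast
    qed
    then have "is_cut D B'" unfolding is_cut_def B'_def by blast
    ultimately have "B' = B" using bond inner unfolding is_bond_def by blast
    then show False using inner meets by blast
  qed
  have "bipartition D Y X" "B = cut_edges D Y X"
    using XY B unfolding bipartition_def cut_edges_def by auto
  with one_side absurd[OF XY B] absurd[of Y X] show False by blast
qed

lemma finite_links: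
  assumes "finite S"
  shows "finite (links D S)"
proof -
  have "finite {(u, v) \<in> ends D S \<times> ends D S. linked D (arcs D - S) u v}"
    by (rule finite_subset[of _ "ends D S \<times> ends D S"]) (use assms in \<open>auto simp: ends_def\<close>)
  then show ?thesis
    unfolding links_def by (rule finite_UN_I) (auto intro: connector(1))
qed

lemma finite_less_infinite:
  assumes "finite A" "infinite Z"
  shows "|A| <o |Z|"
  using assms by (meson card_of_Well_order card_of_ordLeq_finite not_ordLeq_iff_ordLess)

lemmas finite_leq_infinite = ordLess_imp_ordLeq[OF finite_less_infinite]

lemma card_Un_ordLeq:
  assumes "infinite Z" "|A| \<le>o |Z|" "|B| \<le>o |Z|"
  shows "|A \<union> B| \<le>o |Z|"
  using card_of_Un_ordLeq_infinite_Field[of "|Z|" A B] assms card_of_Card_order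
  by (metis Field_card_of)

lemma card_links:
  fixes Z :: "'c set"
  assumes inf: "infinite Z" and "|S| \<le>o |Z|"
  shows "|links D S| \<le>o |Z|"
proof -
  have "|ends D S| \<le>o |Z|"
    unfolding ends_def
    using assms by (intro card_Un_ordLeq) (auto intro: ordLeq_transitive[OF card_of_image])
  then have "|ends D S \<times> ends D S| \<le>o |Z|"
    using inf by (intro card_of_Sigma_ordLeq_infinite) auto
  then have "|{(u, v) \<in> ends D S \<times> ends D S. linked D (arcs D - S) u v}| \<le>o |Z|"
    by (rule ordLeq_transitive[OF card_of_mono1, rotated]) auto
  then show ?thesis
    unfolding links_def
    by (intro card_of_UNION_ordLeq_infinite[OF inf])
      (auto intro!: finite_leq_infinite[OF _ inf] intro: connector(1))
qed

section \<open>Stages smaller than a given cardinal\<close>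

text \<open>
  The predecessors in a fixed well-order of \<open>C\<close> whose proper initial segments all have size less than \<open>|C|\<close>.
\<close>
abbreviation below :: "'c set \<Rightarrow> 'c \<Rightarrow> 'c set" where
  "below C a \<equiv> Order_Relation.underS (card_of C) a"

text \<open>
  The bound \<open>|S a| <o |C|\<close> is not inherited at limit steps if \<open>|C|\<close> is singular. What is
  inherited is that \<open>S a\<close> is finite if \<open>a\<close> has finitely many predecessors and is
  otherwise no larger than the set of predecessors. The two hypotheses on \<open>N\<close> are the two
  cases of this invariant, and sets of predecessors are smaller than \<open>C\<close>.
\<close>
lemma small_stages:
  fixes C :: "'c set" and N :: "'b set \<Rightarrow> 'b set"
  assumes inf: "infinite C"
    and fin_N: "\<And>S. finite S \<Longrightarrow> finite (N S)"
    and card_N: "\<And>S (Z :: 'c set). infinite Z \<Longrightarrow> |S| \<le>o |Z| \<Longrightarrow> |N S| \<le>o |Z|"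
  shows "\<exists>S. (\<forall>a. S a = insert e0 (\<Union>b\<in>below C a. N (S b))) \<and> (\<forall>a\<in>C. |S a| <o |C| )"
proof -
  interpret wo: wo_rel "|C|"
    unfolding wo_rel_def by (rule card_of_Well_order)
  let ?R = "|C| - Id"
  have wf: "wf ?R" by (rule wo.WF)
  define F where "F = (\<lambda>S a. insert e0 (\<Union>b\<in>below C a. N (S b)))"
  have "adm_wf ?R F"
    unfolding adm_wf_def F_def underS_def by auto
  then have "wfrec ?R F = F (wfrec ?R F)"
    by (rule wfrec_fixpoint[OF wf])
  then obtain S where "S = F S" by blast
  then have S: "S a = insert e0 (\<Union>b\<in>below C a. N (S b))" for a
    unfolding F_def by meson
  have underS_mono: "below C b \<subseteq> below C a" if "b \<in> below C a" for a b
    using that wo.TRANS wo.ANTISYM unfolding underS_def trans_def antisym_def by blast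
  have size: "(finite (below C a) \<longrightarrow> finite (S a)) \<and>
      (infinite (below C a) \<longrightarrow> |S a| \<le>o |below C a| )" for a
    using wf
  proof (induction a rule: wf_induct_rule)
    case (less a)
    have IH: "finite (below C b) \<Longrightarrow> finite (S b)"
        "infinite (below C b) \<Longrightarrow> |S b| \<le>o |below C b|" if "b \<in> below C a" for b
      using less[of b] that unfolding underS_def by auto
    show ?case
    proof (cases "finite (below C a)")
      case True
      then have "finite (N (S b))" if "b \<in> below C a" for b
        using underS_mono[OF that] IH(1)[OF that] fin_N finite_subset by blast
      then show ?thesis using True unfolding S[of a] by auto
    next
      case False
      have "|N (S b)| \<le>o |below C a|" if b: "b \<in> below C a" for b
      proof (rule card_N[OF False], cases "finite (below C b)")
        case True
        then show "|S b| \<le>o |below C a|"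
          using IH(1)[OF b] finite_leq_infinite[OF _ False] by blast
      next
        case False
        then show "|S b| \<le>o |below C a|"
          using IH(2)[OF b] card_of_mono1[OF underS_mono[OF b]] ordLeq_transitive by blast
      qed
      then have "|\<Union>b\<in>below C a. N (S b)| \<le>o |below C a|"
        using False by (intro card_of_UNION_ordLeq_infinite) (auto intro: card_of_mono1)
      then have "|{e0} \<union> (\<Union>b\<in>below C a. N (S b))| \<le>o |below C a|"
        using False finite_leq_infinite[of "{e0}", OF _ False]
        by (intro card_Un_ordLeq) auto
      then show ?thesis using False unfolding S[of a] by simp
    qed
  qed
  have "|S a| <o |C|" if "a \<in> C" for a
  proof (cases "finite (below C a)")
    case True
    then have "finite (S a)" using size by blast
    then show ?thesis using inf finite_less_infinite by blast
  next
    case False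
    then have "|S a| \<le>o |below C a|" using size by blast
    also have "|below C a| <o |C|"
      using that card_of_underS[OF card_of_Card_order] by (simp add: Field_card_of)
    finally (ordLeq_ordLess_trans) show ?thesis .
  qed
  with S show ?thesis by blast
qed

text \<open>
  Identify \<open>C\<close> with \<open>C \<times> C\<close> and let \<open>c\<close> be the first projection. Its fibres have size \<open>|C|\<close>, so none
  of them fits into a proper initial segment.
\<close>
lemma cofinal_colours:
  assumes inf: "infinite C"
  shows "\<exists>c :: 'c \<Rightarrow> 'c. \<forall>a\<in>C. \<forall>d\<in>C. \<exists>b\<in>C. c b = d \<and> a \<in> below C b"
proof -
  have "|C \<times> C| =o |C|" using inf by (rule card_of_Times_same_infinite)
  then obtain h where h: "bij_betw h (C \<times> C) C" unfolding card_of_ordIso[symmetric] by blast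
  define c where "c = fst \<circ> inv_into (C \<times> C) h"
  have ch: "c (h (d, x)) = d" if "d \<in> C" "x \<in> C" for d x
    unfolding c_def using that h by (simp add: bij_betw_inv_into_left)
  have "\<exists>b\<in>C. c b = d \<and> a \<in> below C b" if a: "a \<in> C" and d: "d \<in> C" for a d
  proof (rule ccontr)
    interpret wo: wo_rel "|C|"
      unfolding wo_rel_def by (rule card_of_Well_order)
    assume none: "\<not> ?thesis"
    let ?U = "insert a (below C a)"
    have "h (d, x) \<in> ?U" if x: "x \<in> C" for x
    proof -
      have "h (d, x) \<in> C" using h d x by (auto dest: bij_betwE)
      then show ?thesis
        using none ch[OF d x] a wo.TOTALS unfolding underS_def Field_card_of by auto
    qed
    moreover have "inj_on (\<lambda>x. h (d, x)) C"
      using h d by (auto simp: bij_betw_def inj_on_def)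
    ultimately have "|C| \<le>o |?U|" by (intro card_of_ordLeqI) auto
    moreover have "|{a} \<union> below C a| <o |C|"
      using inf a card_of_underS[OF card_of_Card_order, of a C] finite_less_infinite[of "{a}" C]
      by (intro card_of_Un_ordLess_infinite) (auto simp: Field_card_of)
    ultimately show False using not_ordLess_ordLeq by auto
  qed
  then show ?thesis by blast
qed

section \<open>Colouring the edges so that every large bond has all colours\<close>

text \<open>
  A partial colouring is a single-valued relation between edges and colours. The set \<open>M\<close>
  stands for the edges coloured earlier. The seed \<open>e0\<close> belongs to every stage
  but need not be coloured; bonds through it are settled all the same.
\<close>
lemma partial_colouring:
  fixes D :: "('a,'b) pre_digraph" and C :: "'c set"
  assumes wf: "wf_digraph D" and inf: "infinite C"
  obtains g :: "('b \<times> 'c) set"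
  where "single_valued g" "Domain g \<inter> M = {}"
    and "\<And>B d. is_bond D B \<Longrightarrow> |C| \<le>o |B| \<Longrightarrow> B \<inter> M = {} \<Longrightarrow>
      B \<inter> insert e0 (Domain g) \<noteq> {} \<Longrightarrow> d \<in> C \<Longrightarrow> \<exists>e\<in>B. (e, d) \<in> g"
proof -
  define N where "N = (\<lambda>S. links D S - M)"
  have fin_N: "finite (N S)" if "finite S" for S
    unfolding N_def using finite_links[OF that] by blast
  have card_N: "|N S| \<le>o |Z|" if "infinite Z" "|S| \<le>o |Z|" for S and Z :: "'c set"
    unfolding N_def using card_links[OF that] card_of_mono1[of "links D S - M"] ordLeq_transitive
    by blast
  obtain S where S: "\<And>a. S a = insert e0 (\<Union>b\<in>below C a. N (S b))"
    and S_small: "\<And>a. a \<in> C \<Longrightarrow> |S a| <o |C|"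
    using small_stages[of C N e0, OF inf fin_N card_N] by metis
  obtain c :: "'c \<Rightarrow> 'c"
    where c: "\<forall>a\<in>C. \<forall>d\<in>C. \<exists>b\<in>C. c b = d \<and> a \<in> below C b"
    using cofinal_colours[OF inf] by (rule exE)
  define g where "g = {(e, c a) | e a. a \<in> C \<and> e \<in> N (S a)}"
  interpret wo: wo_rel "|C|"
    unfolding wo_rel_def by (rule card_of_Well_order)
  have later: "N (S b) \<inter> N (S a) = {}" if "b \<in> below C a" for a b
    using that S[of a] links_disjoint[of D "S a"] unfolding N_def by blast
  have "a = b" if "a \<in> C" "b \<in> C" "e \<in> N (S a)" "e \<in> N (S b)" for a b e
  proof (rule ccontr)
    assume "a \<noteq> b"
    then have "a \<in> below C b \<or> b \<in> below C a"
      using that(1,2) wo.TOTALS unfolding underS_def Field_card_of by auto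
    then show False using later that(3,4) by blast
  qed
  then have "single_valued g" unfolding single_valued_def g_def by blast
  moreover have "Domain g \<inter> M = {}" unfolding g_def N_def by blast
  moreover have "\<exists>e\<in>B. (e, d) \<in> g"
    if bond: "is_bond D B" and large: "|C| \<le>o |B|" and M: "B \<inter> M = {}"
      and meets: "B \<inter> insert e0 (Domain g) \<noteq> {}" and d: "d \<in> C" for B d
  proof -
    \<comment> \<open>The links added at step \<open>a\<close> belong only to the stages after \<open>a\<close>, so \<open>S a\<close> itself may avoid \<open>B\<close>.\<close>
    obtain a where a: "a \<in> C" "\<And>b. a \<in> below C b \<Longrightarrow> B \<inter> S b \<noteq> {}"
    proof (cases "e0 \<in> B")
      case True
      obtain a where "a \<in> C" using d by blast
      then show thesis using that[of a] True S by blast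
    next
      case False
      then obtain a where "a \<in> C" "B \<inter> N (S a) \<noteq> {}" using meets unfolding g_def by blast
      then show thesis using that[of a] S by blast
    qed
    obtain b where b: "b \<in> C" "c b = d" "a \<in> below C b" using c a(1) d by blast
    have "\<not> B \<subseteq> S b"
    proof
      assume "B \<subseteq> S b"
      then have "|C| \<le>o |S b|" using large card_of_mono1 ordLeq_transitive by blast
      then show False using S_small[OF b(1)] not_ordLess_ordLeq by blast
    qed
    then obtain e where "e \<in> B" "e \<in> links D (S b)"
      using bond_meets_links[OF wf bond a(2)[OF b(3)]] by blast
    then have "e \<in> B" "(e, c b) \<in> g" using M b(1) unfolding g_def N_def by auto
    then show ?thesis using b(2) by blast
  qed
  ultimately show ?thesis by (rule that)
qed

text \<open>
  Consider the partial colourings that give all colours to every large bond they touch. A bond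
  touched by the union of a chain of them is already touched by a member of the chain, so the union
  has the same property. A large bond that avoids a maximal one would allow a proper extension, by a partial colouring
  seeded at one of its edges.
\<close>
theorem bond_colouring:
  fixes D :: "('a,'b) pre_digraph" and C :: "'c set"
  assumes wf: "wf_digraph D" and inf: "infinite C"
  obtains f :: "'b \<Rightarrow> 'c" where "\<And>B. is_bond D B \<Longrightarrow> |C| \<le>o |B| \<Longrightarrow> C \<subseteq> f ` B"
proof -
  define \<G> where "\<G> = {g :: ('b \<times> 'c) set. single_valued g \<and>
    (\<forall>B. is_bond D B \<longrightarrow> |C| \<le>o |B| \<longrightarrow> B \<inter> Domain g \<noteq> {} \<longrightarrow> (\<forall>d\<in>C. \<exists>e\<in>B. (e, d) \<in> g))}"
  have "\<exists>g\<in>\<G>. \<forall>h\<in>\<G>. g \<subseteq> h \<longrightarrow> h = g"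
  proof (rule subset_Zorn')
    fix \<C> assume chain: "subset.chain \<G> \<C>"
    then have sub: "\<C> \<subseteq> \<G>" and lin: "\<And>g h. g \<in> \<C> \<Longrightarrow> h \<in> \<C> \<Longrightarrow> g \<subseteq> h \<or> h \<subseteq> g"
      unfolding subset_chain_def by blast+
    have "single_valued (\<Union>\<C>)"
    proof (rule single_valuedI)
      fix x y z assume "(x, y) \<in> \<Union>\<C>" "(x, z) \<in> \<Union>\<C>"
      then obtain g where "g \<in> \<C>" "(x, y) \<in> g" "(x, z) \<in> g" using lin by blast
      then show "y = z" using sub unfolding \<G>_def single_valued_def by blast
    qed
    moreover have "\<exists>e\<in>B. (e, d) \<in> \<Union>\<C>"
      if B: "is_bond D B" "|C| \<le>o |B|" "B \<inter> Domain (\<Union>\<C>) \<noteq> {}" and "d \<in> C" for B d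
    proof -
      obtain g where g: "g \<in> \<C>" "B \<inter> Domain g \<noteq> {}" using B(3) by blast
      then have "\<exists>e\<in>B. (e, d) \<in> g" using sub B \<open>d \<in> C\<close> unfolding \<G>_def by blast
      then show ?thesis using g(1) by blast
    qed
    ultimately show "\<Union>\<C> \<in> \<G>" unfolding \<G>_def by blast
  qed
  then obtain g where g: "g \<in> \<G>" and maximal: "\<And>h. h \<in> \<G> \<Longrightarrow> g \<subseteq> h \<Longrightarrow> h = g" by blast
  have all: "\<exists>e\<in>B. (e, d) \<in> g" if B: "is_bond D B" "|C| \<le>o |B|" and d: "d \<in> C" for B d
  proof (cases "B \<inter> Domain g = {}")
    case False
    then show ?thesis using g B d unfolding \<G>_def by blast
  next
    case True
    obtain e0 where e0: "e0 \<in> B" using B(1) unfolding is_bond_def by blast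
    obtain h :: "('b \<times> 'c) set" where h: "single_valued h" "Domain h \<inter> Domain g = {}"
      and h_all: "\<And>B d. is_bond D B \<Longrightarrow> |C| \<le>o |B| \<Longrightarrow> B \<inter> Domain g = {} \<Longrightarrow>
        B \<inter> insert e0 (Domain h) \<noteq> {} \<Longrightarrow> d \<in> C \<Longrightarrow> \<exists>e\<in>B. (e, d) \<in> h"
      using partial_colouring[OF wf inf, of "Domain g" e0] by blast
    have "single_valued (g \<union> h)"
    proof (rule single_valuedI)
      fix x y z assume "(x, y) \<in> g \<union> h" "(x, z) \<in> g \<union> h"
      then have "(x, y) \<in> g \<and> (x, z) \<in> g \<or> (x, y) \<in> h \<and> (x, z) \<in> h" using h(2) by blast
      moreover have "single_valued g" using g unfolding \<G>_def by blast
      ultimately show "y = z" using h(1) by (auto dest: single_valuedD)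
    qed
    moreover have "\<exists>e\<in>B'. (e, d') \<in> g \<union> h"
      if B': "is_bond D B'" "|C| \<le>o |B'|" "B' \<inter> Domain (g \<union> h) \<noteq> {}" and d': "d' \<in> C" for B' d'
    proof (cases "B' \<inter> Domain g = {}")
      case True
      then show ?thesis using h_all[OF B'(1,2) True _ d'] B'(3) by blast
    next
      case False
      then have "\<exists>e\<in>B'. (e, d') \<in> g" using g B' d' unfolding \<G>_def by blast
      then show ?thesis by blast
    qed
    ultimately have "g \<union> h \<in> \<G>" unfolding \<G>_def by blast
    then have "h \<subseteq> g" using maximal by blast
    moreover have "\<exists>e\<in>B. (e, d) \<in> h" using h_all[OF B True _ d] e0 by blast
    ultimately show ?thesis by blast
  qed
  define f where "f = (\<lambda>e. SOME d. (e, d) \<in> g)"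
  have f: "f e = d" if "(e, d) \<in> g" for e d
    using that g someI[of "\<lambda>d. (e, d) \<in> g" d] unfolding f_def \<G>_def single_valued_def by blast
  have "C \<subseteq> f ` B" if "is_bond D B" "|C| \<le>o |B|" for B
    using all[OF that] f by blast
  then show ?thesis by (rule that)
qed

section \<open>Disjoint dijoins\<close>

lemma lepoll_iff_ordLeq: "A \<lesssim> B \<longleftrightarrow> |A| \<le>o |B|"
  unfolding lepoll_def card_of_ordLeq[symmetric] ..

lemma smallest_in_exists:
  assumes "\<BB> \<noteq> {}"
  obtains B where "smallest_in \<BB> B"
proof -
  have "\<exists>r \<in> card_of ` \<BB>. \<forall>r' \<in> card_of ` \<BB>. r \<le>o r'"
    using assms card_of_Well_order by (intro exists_minim_Well_order) blast+
  with that show ?thesis unfolding smallest_in_def lepoll_iff_ordLeq by blast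
qed

lemma disjoint_dijoins_lepoll:
  assumes "disjoint_dijoins D \<BB> \<JJ>" "B \<in> \<BB>"
  shows "\<JJ> \<lesssim> B"
proof -
  have "\<forall>F\<in>\<JJ>. \<exists>e. e \<in> F \<inter> B"
    using assms unfolding disjoint_dijoins_def is_dijoin_def by blast
  from bchoice[OF this] obtain p where p: "\<And>F. F \<in> \<JJ> \<Longrightarrow> p F \<in> F \<inter> B" by blast
  have "inj_on p \<JJ>"
  proof (rule inj_onI)
    fix F G assume FG: "F \<in> \<JJ>" "G \<in> \<JJ>" "p F = p G"
    then have "F \<inter> G \<noteq> {}" using p[of F] p[of G] by auto
    then show "F = G"
      using assms(1) FG unfolding disjoint_dijoins_def pairwise_def disjnt_def by blast
  qed
  then show ?thesis unfolding lepoll_def using p by blast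
qed

theorem theorem5:
  fixes D :: "('a,'b) pre_digraph" and \<BB> :: "'b set set"
  assumes "loopfree_digraph D"
    and "\<BB> \<noteq> {}"
    and "\<forall>B\<in>\<BB>. is_dibond D B \<and> infinite B"
  shows "\<exists>B \<JJ>. smallest_in \<BB> B \<and> largest_disjoint_dijoins D \<BB> \<JJ> \<and> B \<approx> \<JJ>"
proof -
  have wf: "wf_digraph D" using assms(1) by (simp add: loopfree_digraph_def)
  obtain C where C: "smallest_in \<BB> C" using assms(2) by (rule smallest_in_exists)
  then have "C \<in> \<BB>" unfolding smallest_in_def by blast
  then have inf: "infinite C" using assms(3) by blast
  obtain f :: "'b \<Rightarrow> 'b" where f: "\<And>B. is_bond D B \<Longrightarrow> |C| \<le>o |B| \<Longrightarrow> C \<subseteq> f ` B"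
    using bond_colouring[OF wf inf] by blast
  have hit: "\<exists>e \<in> arcs D \<inter> B. f e = d" if "B \<in> \<BB>" "d \<in> C" for B d
  proof -
    have bond: "is_bond D B" using assms(3) that(1) unfolding is_dibond_def by blast
    have "B \<subseteq> arcs D" using bond by (rule is_bondE) (auto simp: cut_edges_def)
    moreover have "|C| \<le>o |B|"
      using C that(1) unfolding smallest_in_def lepoll_iff_ordLeq by blast
    ultimately show ?thesis using f[OF bond] that(2) by blast
  qed
  define J where "J d = {e \<in> arcs D. f e = d}" for d
  have "is_dijoin D \<BB> (J d)" if "d \<in> C" for d
    unfolding is_dijoin_def J_def using hit that by blast
  moreover have "pairwise disjnt (J ` C)"
    unfolding pairwise_def disjnt_def J_def by auto
  ultimately have dis: "disjoint_dijoins D \<BB> (J ` C)"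
    unfolding disjoint_dijoins_def by blast
  have "inj_on J C"
  proof (rule inj_onI)
    fix d d' assume "d \<in> C" "d' \<in> C" "J d = J d'"
    then show "d = d'" using hit[OF \<open>C \<in> \<BB>\<close> \<open>d \<in> C\<close>] unfolding J_def by blast
  qed
  then have eq: "C \<approx> J ` C"
    by (meson eqpoll_sym inj_on_image_eqpoll_self)
  have "\<JJ>' \<lesssim> J ` C" if "disjoint_dijoins D \<BB> \<JJ>'" for \<JJ>'
    using disjoint_dijoins_lepoll[OF that \<open>C \<in> \<BB>\<close>] eq lepoll_trans2 by blast
  with dis have "largest_disjoint_dijoins D \<BB> (J ` C)"
    unfolding largest_disjoint_dijoins_def by blast
  with C eq show ?thesis by blast
qed

end
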